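(* Let $p\in\mathbb{N}$, $j=\begin{bmatrix} I_p&0\\0&-I_p\end{bmatrix}$, let $c\in\mathbb{R}$, $c\neq0$, let $\alpha$ be a $p\times p$ matrix with $\alpha\alpha^*=I_p$, and let $$H(x)=\mathrm{e}^{-\mathrm{i}cxj}\mathcal{K}\,\mathrm{e}^{\mathrm{i}cxj},\qquad \mathcal{K}=\begin{bmatrix} I_p&\alpha\\ \alpha^*&I_p\end{bmatrix}.$$ Let $\lambda\in\mathbb{C}$ with $\Im(\lambda)\neq0$. Then the fundamental solution $W(x,\lambda)$ (normalized by $W(0,\lambda)=I_{2p}$) of the canonical system $w'(x,\lambda)=\mathrm{i}\lambda jH(x)w(x,\lambda)$ has the form $$W(x,\lambda)=\mathrm{e}^{-\mathrm{i}cxj}E(\lambda)\begin{bmatrix}\mathrm{e}^{\mathrm{i}z_1(\lambda)x}I_p&0\\0&\mathrm{e}^{\mathrm{i}z_2(\lambda)x}I_p\end{bmatrix}E(\lambda)^{-1},\qquad E=\begin{bmatrix}E_1&E_2\end{bmatrix},$$ where $$E_i(\lambda)=\begin{bmatrix}-\alpha\\ \frac1\lambda(\lambda+c-z_i(\lambda))I_p\end{bmatrix}\quad(i=1,2),$$ and $z_1(\lambda),z_2(\lambda)$ are the two roots of $z^2=c(2\lambda+c)$, with $\Im(z_1(\lambda))>0$ (so $z_2=-z_1$).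
   Context: $^*$ is the conjugate transpose, $'$ is $d/dx$, and $x\ge 0$. A fundamental solution is a $2p\times2p$ matrix solution that is invertible. *)

theory Defs
  imports "HOL-Analysis.Analysis"
begin

text \<open>
  Matrices with \<open>m\<close> rows and \<open>n\<close> columns have type \<open>complex^'n^'m\<close>.  The index type
  \<open>'p + 'p\<close> makes a \<open>2p \<times> 2p\<close> matrix a \<open>2 \<times> 2\<close> block matrix with \<open>p \<times> p\<close> blocks,
  where \<open>p = CARD('p)\<close>.
\<close>

definition hcat :: "'a^'n^'m \<Rightarrow> 'a^'k^'m \<Rightarrow> 'a^('n + 'k)^'m" where
  "hcat A B = (\<chi> i j. case j of Inl l \<Rightarrow> A $ i $ l | Inr l \<Rightarrow> B $ i $ l)"

definition vcat :: "'a^'n^'m \<Rightarrow> 'a^'n^'k \<Rightarrow> 'a^'n^('m + 'k)" where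
  "vcat A B = (\<chi> i. case i of Inl l \<Rightarrow> A $ l | Inr l \<Rightarrow> B $ l)"

definition block_mat ::
  "'a^'n^'m \<Rightarrow> 'a^'k^'m \<Rightarrow> 'a^'n^'l \<Rightarrow> 'a^'k^'l \<Rightarrow> 'a^('n + 'k)^('m + 'l)" where
  "block_mat A B C D = vcat (hcat A B) (hcat C D)"

definition cscale :: "complex \<Rightarrow> complex^'n^'m \<Rightarrow> complex^'n^'m" (infixr \<open>*\<^sub>C\<close> 75) where
  "a *\<^sub>C A = (\<chi> i j. a * A $ i $ j)"

definition ctranspose :: "complex^'n^'m \<Rightarrow> complex^'m^'n" where
  "ctranspose A = (\<chi> i j. cnj (A $ j $ i))"

text \<open>
  The generic \<open>exp\<close>, \<open>*\<close> and \<open>^\<close> are not usable here: on \<open>vec\<close> the product \<open>*\<close> is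
  componentwise, and \<open>vec\<close> is not a normed algebra.
\<close>

primrec mat_pow :: "complex^'n^'n \<Rightarrow> nat \<Rightarrow> complex^'n^'n" where
  "mat_pow A 0 = mat 1"
| "mat_pow A (Suc k) = A ** mat_pow A k"

definition mat_exp :: "complex^'n^'n \<Rightarrow> complex^'n^'n" where
  "mat_exp A = (\<Sum>k. mat_pow A k /\<^sub>R fact k)"

definition J :: "complex^('p::finite + 'p)^('p + 'p)" where
  "J = block_mat (mat 1) 0 0 (- mat 1)"

definition K :: "complex^'p^'p \<Rightarrow> complex^('p::finite + 'p)^('p + 'p)" where
  "K \<alpha> = block_mat (mat 1) \<alpha> (ctranspose \<alpha>) (mat 1)"

definition H :: "real \<Rightarrow> complex^'p^'p \<Rightarrow> real \<Rightarrow> complex^('p::finite + 'p)^('p + 'p)" where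
  "H c \<alpha> x =
     mat_exp ((- (\<i> * of_real c * of_real x)) *\<^sub>C J) ** K \<alpha> **
     mat_exp ((\<i> * of_real c * of_real x) *\<^sub>C J)"

text \<open>
  The system \<open>w' = \<i> lam j H w\<close> on \<open>x \<ge> 0\<close> (one-sided derivative at \<open>0\<close>), for one fixed value
  of \<open>lam\<close>.
\<close>

definition canonical_solution ::
  "(real \<Rightarrow> complex^('p::finite + 'p)^('p + 'p)) \<Rightarrow> complex \<Rightarrow>
   (real \<Rightarrow> complex^('p + 'p)^('p + 'p)) \<Rightarrow> bool" where
  "canonical_solution Ham lam W \<longleftrightarrow>
     (\<forall>x\<ge>0. (W has_vector_derivative (\<i> * lam) *\<^sub>C (J ** Ham x ** W x)) (at x within {0..}))"

definition fundamental_solution ::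
  "(real \<Rightarrow> complex^('p::finite + 'p)^('p + 'p)) \<Rightarrow> complex \<Rightarrow>
   (real \<Rightarrow> complex^('p + 'p)^('p + 'p)) \<Rightarrow> bool" where
  "fundamental_solution Ham lam W \<longleftrightarrow>
     canonical_solution Ham lam W \<and> (\<forall>x\<ge>0. invertible (W x))"

definition E_col :: "real \<Rightarrow> complex^'p^'p \<Rightarrow> complex \<Rightarrow> complex \<Rightarrow> complex^'p^('p + 'p)" where
  "E_col c \<alpha> lam z = vcat (- \<alpha>) (((1 / lam) * (lam + of_real c - z)) *\<^sub>C mat 1)"

definition E_mat ::
  "real \<Rightarrow> complex^'p^'p \<Rightarrow> complex \<Rightarrow> complex \<Rightarrow> complex \<Rightarrow> complex^('p::finite + 'p)^('p + 'p)" where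
  "E_mat c \<alpha> lam z\<^sub>1 z\<^sub>2 = hcat (E_col c \<alpha> lam z\<^sub>1) (E_col c \<alpha> lam z\<^sub>2)"

end

theory Submission
  imports Defs
begin

text \<open>
  The rotation \<open>e\<^bsup>icxj\<^esup>\<close> removes the dependence of the system on \<open>x\<close>.  It commutes with \<open>j\<close>, so
  for \<open>w(x) = e\<^bsup>-icxj\<^esup> v(x)\<close> the system \<open>w' = i\<lambda>jHw\<close> becomes \<open>v' = iAv\<close> with the constant matrix
  \<open>A = cj + \<lambda>jK\<close>.  The diagonal blocks of \<open>A\<close> are \<open>\<plusminus>(\<lambda> + c)I\<close> and the other two are \<open>\<lambda>\<alpha>\<close> and
  \<open>-\<lambda>\<alpha>\<^sup>*\<close>; since \<open>\<alpha>\<close> is unitary, \<open>A\<^sup>2 = ((\<lambda> + c)\<^sup>2 - \<lambda>\<^sup>2)I = c(2\<lambda> + c)I\<close>.  Hence the eigenvalues of \<open>A\<close> are the roots \<open>\<plusminus>z\<close>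
  of \<open>z\<^sup>2 = c(2\<lambda> + c)\<close>, the columns of \<open>E\<close> are eigenvectors, and \<open>AE = zEj\<close> (lemma
  \<open>E_mat_diagonalizes\<close>).  The matrix \<open>E\<close> is invertible because its two block columns differ only in
  the scalar factor \<open>(\<lambda> + c \<mp> z)/\<lambda>\<close> of the lower block and \<open>\<alpha>\<close> is invertible (lemma
  \<open>invertible_E_mat\<close>).  As \<open>c(2\<lambda> + c)\<close> is not real, no root is real, so exactly one of them lies in
  the upper half plane (lemma \<open>quadratic_root_upper_half_plane\<close>).

  Therefore \<open>F(x) = e\<^bsup>-icxj\<^esup> E e\<^bsup>izxj\<^esup> E\<^bsup>-1\<^esup>\<close> solves the system (lemma \<open>rotated_system_solution\<close>); it
  is a product of invertible matrices, and \<open>F(0) = I\<close>.  It is the only normalized solution, because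
  for any solution \<open>W\<close> the derivative of \<open>F\<^bsup>-1\<^esup>W\<close> vanishes (lemma \<open>linear_system_unique\<close>).
\<close>

section \<open>Scaling and multiplication of complex matrices\<close>

lemma cscale_nth [simp]: "(a *\<^sub>C A) $ i $ j = a * A $ i $ j"
  by (simp add: cscale_def)

lemma cscale_mult_left: "(a *\<^sub>C A) ** B = a *\<^sub>C (A ** B)"
  by (simp add: vec_eq_iff matrix_matrix_mult_def sum_distrib_left mult.assoc)

lemma cscale_mult_right: "A ** (a *\<^sub>C B) = a *\<^sub>C (A ** B)"
  by (simp add: vec_eq_iff matrix_matrix_mult_def sum_distrib_left mult.left_commute)

lemma cscale_cscale: "a *\<^sub>C (b *\<^sub>C A) = (a * b) *\<^sub>C A"
  by (simp add: vec_eq_iff mult.assoc)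

lemma cscale_add_right: "a *\<^sub>C (A + B) = a *\<^sub>C A + a *\<^sub>C B"
  by (simp add: vec_eq_iff distrib_left)

lemma cscale_add_left: "(a + b) *\<^sub>C A = a *\<^sub>C A + b *\<^sub>C A"
  by (simp add: vec_eq_iff distrib_right)

lemma cscale_one: "1 *\<^sub>C A = A"
  by (simp add: vec_eq_iff)

lemma cscale_zero: "0 *\<^sub>C A = 0" "a *\<^sub>C 0 = 0"
  by (simp_all add: vec_eq_iff)

lemma uminus_eq_cscale: "- A = (- 1) *\<^sub>C A" for A :: "complex^'n^'m"
  by (simp add: vec_eq_iff)

lemma matrix_mult_zero: "A ** 0 = 0" "0 ** A = 0" for A :: "complex^'n^'m"
  by (simp_all add: vec_eq_iff matrix_matrix_mult_def)

lemma matrix_add_rdistrib: "(A + B) ** C = A ** C + B ** C"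
  for A :: "complex^'n^'m"
  by (simp add: vec_eq_iff matrix_matrix_mult_def distrib_right sum.distrib)

lemma bounded_bilinear_matrix_mult:
  "bounded_bilinear ((**) :: complex^'n^'m \<Rightarrow> complex^'k^'n \<Rightarrow> complex^'k^'m)"
  unfolding bilinear_conv_bounded_bilinear [symmetric] bilinear_def
  by (auto intro!: linearI
      simp: vec_eq_iff matrix_matrix_mult_def
            scaleR_sum_right sum.distrib algebra_simps)

lemma invertible_matrix_inv:
  assumes "invertible A"
  shows "A ** matrix_inv A = mat 1" "matrix_inv A ** A = mat 1"
  using someI_ex [OF assms [unfolded invertible_def]] unfolding matrix_inv_def by auto

section \<open>Block matrices\<close>

lemma block_mat_nth:
  "block_mat A B C D $ Inl i $ Inl k = A $ i $ k"
  "block_mat A B C D $ Inl i $ Inr l = B $ i $ l"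
  "block_mat A B C D $ Inr j $ Inl k = C $ j $ k"
  "block_mat A B C D $ Inr j $ Inr l = D $ j $ l"
  by (simp_all add: block_mat_def vcat_def hcat_def)

text \<open>
  Block identities are proved by comparing entries; splitting the row and column indices into
  their two summands lets the simplifier evaluate each block.
\<close>

lemma block_mat_eq_iff:
  "M = N \<longleftrightarrow>
     (\<forall>i k. M $ Inl i $ Inl k = N $ Inl i $ Inl k) \<and> (\<forall>i l. M $ Inl i $ Inr l = N $ Inl i $ Inr l) \<and>
     (\<forall>j k. M $ Inr j $ Inl k = N $ Inr j $ Inl k) \<and> (\<forall>j l. M $ Inr j $ Inr l = N $ Inr j $ Inr l)"
  for M :: "'a^('n::finite + 'k::finite)^('m::finite + 'l::finite)"
  unfolding vec_eq_iff by (metis sum.exhaust)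

lemma sum_UNIV_sum_type:
  "(\<Sum>k\<in>UNIV. f k) = (\<Sum>k\<in>UNIV. f (Inl k)) + (\<Sum>k\<in>UNIV. f (Inr k))"
  for f :: "'a::finite + 'b::finite \<Rightarrow> 'c::comm_monoid_add"
  unfolding UNIV_Plus_UNIV [symmetric] by (subst sum.Plus) simp_all

lemma block_mat_mult:
  "block_mat A B C D ** block_mat A' B' C' D' =
     block_mat (A ** A' + B ** C') (A ** B' + B ** D') (C ** A' + D ** C') (C ** B' + D ** D')"
  for A :: "complex^'n^'m"
  by (simp add: block_mat_eq_iff block_mat_nth matrix_matrix_mult_def sum_UNIV_sum_type)

lemma block_mat_add:
  "block_mat A B C D + block_mat A' B' C' D' = block_mat (A + A') (B + B') (C + C') (D + D')"
  for A :: "complex^'n::finite^'m::finite"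
  by (simp add: block_mat_eq_iff block_mat_nth)

lemma cscale_block_mat:
  "a *\<^sub>C block_mat A B C D = block_mat (a *\<^sub>C A) (a *\<^sub>C B) (a *\<^sub>C C) (a *\<^sub>C D)"
  by (simp add: block_mat_eq_iff block_mat_nth)

lemma mat_1_block: "mat 1 = block_mat (mat 1) 0 0 (mat 1 :: complex^'l::finite^'l)"
  by (simp add: block_mat_eq_iff block_mat_nth mat_def)

section \<open>The rotation \<open>exp (\<i> a x J)\<close>\<close>

text \<open>
  The matrices \<open>diag(aI, bI)\<close> form a commutative algebra that contains \<open>j\<close> and all its
  exponentials, so computations with those matrices reduce to computations with pairs of complex
  numbers.
\<close>

definition bdiag :: "complex \<Rightarrow> complex \<Rightarrow> complex^('p::finite + 'p)^('p + 'p)" where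
  "bdiag a b = block_mat (a *\<^sub>C mat 1) 0 0 (b *\<^sub>C mat 1)"

lemma bdiag_mult: "bdiag a b ** bdiag a' b' = bdiag (a * a') (b * b')"
  by (simp add: bdiag_def block_mat_mult cscale_mult_left cscale_mult_right cscale_cscale
      matrix_mult_zero cscale_zero mult.commute)

lemma bdiag_1: "bdiag 1 1 = mat 1"
  by (simp add: bdiag_def cscale_one mat_1_block [symmetric])

lemma J_eq_bdiag: "J = bdiag 1 (- 1)"
  by (simp add: J_def bdiag_def cscale_one uminus_eq_cscale)

lemma cscale_bdiag: "c *\<^sub>C bdiag a b = bdiag (c * a) (c * b)"
  by (simp add: bdiag_def cscale_block_mat cscale_cscale cscale_zero)

text \<open>
  Series and derivatives of pairs of complex numbers are carried over to matrices by this lemma.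
\<close>

lemma bounded_linear_bdiag: "bounded_linear (\<lambda>v. bdiag (fst v) (snd v))"
  unfolding linear_conv_bounded_linear [symmetric]
  by (rule linearI) (auto simp: bdiag_def block_mat_eq_iff block_mat_nth algebra_simps)

lemma mat_pow_bdiag: "mat_pow (bdiag a b) k = bdiag (a ^ k) (b ^ k)"
  by (induction k) (simp_all add: bdiag_1 bdiag_mult)

lemma mat_exp_bdiag:
  "mat_exp (bdiag a b) = (bdiag (exp a) (exp b) :: complex^('p::finite + 'p)^('p + 'p))"
proof -
  let ?B = "\<lambda>v. bdiag (fst v) (snd v) :: complex^('p + 'p)^('p + 'p)"
  interpret bounded_linear ?B by (rule bounded_linear_bdiag)
  have "(\<lambda>k. inverse (fact k) *\<^sub>R (a ^ k, b ^ k)) sums (exp a, exp b)"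
    using exp_converges [of a] exp_converges [of b] unfolding sums_def
    by (simp only: scaleR_Pair sum_prod tendsto_Pair)
  then have "(\<lambda>k. ?B (inverse (fact k) *\<^sub>R (a ^ k, b ^ k))) sums ?B (exp a, exp b)"
    by (rule sums)
  then have "(\<lambda>k. mat_pow (bdiag a b) k /\<^sub>R fact k) sums
      (bdiag (exp a) (exp b) :: complex^('p + 'p)^('p + 'p))"
    unfolding scaleR mat_pow_bdiag by simp
  then show ?thesis
    by (simp add: mat_exp_def sums_iff)
qed

text \<open>
  The matrix \<open>e\<^bsup>iaxj\<^esup>\<close>, with a complex \<open>a\<close>: the outer factor \<open>e\<^bsup>-icxj\<^esup>\<close> and the diagonal matrix of the
  numbers \<open>e\<^bsup>\<plusminus>izx\<^esup>\<close> are both of this form.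
\<close>

definition rot :: "complex \<Rightarrow> real \<Rightarrow> complex^('p::finite + 'p)^('p + 'p)" where
  "rot a x = bdiag (exp (\<i> * a * of_real x)) (exp (- (\<i> * a * of_real x)))"

lemma rot_eq_mat_exp:
  "mat_exp ((\<i> * a * of_real x) *\<^sub>C J) = rot a x"
  "mat_exp ((- (\<i> * a * of_real x)) *\<^sub>C J) = rot (- a) x"
  by (simp_all add: J_eq_bdiag cscale_bdiag mat_exp_bdiag rot_def)

lemma rot_mult: "rot a x ** rot b x = rot (a + b) x"
  by (simp add: rot_def bdiag_mult exp_add [symmetric] algebra_simps)

lemma rot_0: "rot 0 x = mat 1" "rot a 0 = mat 1"
  by (simp_all add: rot_def bdiag_1)

lemma rot_J_commute: "rot a x ** J = J ** rot a x"
  by (simp add: rot_def J_eq_bdiag bdiag_mult)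

lemma rot_has_vector_derivative:
  "(rot a has_vector_derivative (\<i> * a) *\<^sub>C (J ** rot a x)) (at x within S)"
proof -
  have e: "((\<lambda>x. exp (b * of_real x)) has_vector_derivative b * exp (b * of_real x)) (at x within S)"
    for b :: complex
    by (rule has_vector_derivative_real_field) (auto intro!: derivative_eq_intros)
  have "((\<lambda>x. (exp ((\<i> * a) * of_real x), exp ((- (\<i> * a)) * of_real x))) has_vector_derivative
      ((\<i> * a) * exp ((\<i> * a) * of_real x), (- (\<i> * a)) * exp ((- (\<i> * a)) * of_real x)))
      (at x within S)"
    by (intro has_vector_derivative_Pair e)
  from bounded_linear.has_vector_derivative [OF bounded_linear_bdiag this]
  show ?thesis
    by (simp add: rot_def [abs_def] J_eq_bdiag cscale_bdiag bdiag_mult)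
qed

lemmas has_vector_derivative_matrix_mult =
  bounded_bilinear.has_vector_derivative [OF bounded_bilinear_matrix_mult]

section \<open>Linear matrix systems\<close>

text \<open>
  The inverse \<open>Y\<close> of an invertible solution satisfies \<open>Y' = -YB\<close>, as differentiation of \<open>FY = I\<close>
  shows.  Hence \<open>(YW)' = -YBW + YBW = 0\<close> for every solution \<open>W\<close>, and \<open>YW\<close> keeps its initial value.
\<close>

lemma linear_system_unique:
  fixes F Y B W :: "real \<Rightarrow> complex^'n^'n"
  assumes F: "\<And>x. x \<ge> 0 \<Longrightarrow> (F has_vector_derivative B x ** F x) (at x within {0..})"
    and FY: "\<And>x. x \<ge> 0 \<Longrightarrow> F x ** Y x = mat 1"
    and Y: "\<And>x. x \<ge> 0 \<Longrightarrow> \<exists>D. (Y has_vector_derivative D) (at x within {0..})"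
    and W: "\<And>x. x \<ge> 0 \<Longrightarrow> (W has_vector_derivative B x ** W x) (at x within {0..})"
    and "W 0 = F 0" "x \<ge> 0"
  shows "W x = F x"
proof -
  have YF: "Y x ** F x = mat 1" if "x \<ge> 0" for x
    using FY [OF that] by (simp add: matrix_left_right_inverse)
  have "((\<lambda>x. Y x ** W x) has_derivative (\<lambda>h. 0)) (at x within {0..})" if x: "x \<ge> 0" for x
  proof -
    obtain D where D: "(Y has_vector_derivative D) (at x within {0..})"
      using Y x by blast
    \<comment> \<open>The derivative of \<open>F Y\<close>, transported to the constant function that it equals on the half-line.\<close>
    have "((\<lambda>x. mat 1 :: complex^'n^'n) has_vector_derivative F x ** D + B x ** F x ** Y x)
        (at x within {0..})"
      by (rule has_vector_derivative_transform [OF _ _ has_vector_derivative_matrix_mult [OF F [OF x] D]])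
        (use x FY in auto)
    moreover have "at x within {0..} \<noteq> bot"
      using x at_le [of "{x<..}" "{0..}" x] trivial_limit_at_right_real [of x]
      by (metis atLeast_iff bot.extremum_uniqueI greaterThan_iff less_imp_le order_trans subsetI)
    ultimately have "F x ** D + B x ** F x ** Y x = 0"
      using vector_derivative_unique_within has_vector_derivative_const by blast
    \<comment> \<open>Multiplying by \<open>Y\<close> on the left turns \<open>F Y' + B F Y = 0\<close> into \<open>Y' = - Y B\<close>.\<close>
    then have "Y x ** (F x ** D + B x ** F x ** Y x) ** W x = 0"
      by (simp add: matrix_mult_zero)
    then have "Y x ** (B x ** W x) + D ** W x = 0"
      using YF [OF x] FY [OF x]
      by (simp add: matrix_add_ldistrib matrix_add_rdistrib matrix_mul_assoc add.commute)
         (simp add: matrix_mul_assoc [symmetric])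
    then show ?thesis
      using has_vector_derivative_matrix_mult [OF D W [OF x]]
      by (simp add: has_vector_derivative_def)
  qed
  then obtain C where "\<And>x. x \<ge> 0 \<Longrightarrow> Y x ** W x = C"
    using has_derivative_zero_constant [of "{0..}" "\<lambda>x. Y x ** W x"] by auto
  then have "Y x ** W x = Y 0 ** W 0"
    using \<open>x \<ge> 0\<close> by simp
  also have "\<dots> = mat 1"
    using YF [of 0] \<open>W 0 = F 0\<close> by simp
  finally have "F x ** Y x ** W x = F x"
    by (simp add: matrix_mul_assoc [symmetric])
  then show ?thesis
    using FY \<open>x \<ge> 0\<close> by simp
qed

section \<open>Diagonalization\<close>

lemma E_mat_block:
  "E_mat c \<alpha> lam z\<^sub>1 z\<^sub>2 = block_mat ((- 1) *\<^sub>C \<alpha>) ((- 1) *\<^sub>C \<alpha>)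
     ((1 / lam * (lam + of_real c - z\<^sub>1)) *\<^sub>C mat 1) ((1 / lam * (lam + of_real c - z\<^sub>2)) *\<^sub>C mat 1)"
  by (simp add: E_mat_def E_col_def block_mat_eq_iff block_mat_nth hcat_def vcat_def)

text \<open>
  With \<open>a\<^sub>1, a\<^sub>2\<close> the scalars in the lower blocks, \<open>E\<close> is the product of \<open>diag(\<alpha>, I)\<close> with the
  Kronecker product of the \<open>2 \<times> 2\<close> matrix with rows \<open>(-1, -1)\<close> and \<open>(a\<^sub>1, a\<^sub>2)\<close> and the identity; the
  determinant of the latter matrix is \<open>a\<^sub>1 - a\<^sub>2\<close>.  The inverse \<open>?N\<close> in the proof is Cramer's rule
  for it, with \<open>\<alpha>\<close> replaced by its inverse \<open>\<alpha>\<^sup>*\<close>.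
\<close>

lemma invertible_E_mat:
  fixes \<alpha> :: "complex^'p^'p"
  assumes "\<alpha> ** ctranspose \<alpha> = mat 1" "lam \<noteq> 0" "z\<^sub>1 \<noteq> z\<^sub>2"
  shows "invertible (E_mat c \<alpha> lam z\<^sub>1 z\<^sub>2)"
proof -
  define a\<^sub>1 where "a\<^sub>1 = 1 / lam * (lam + of_real c - z\<^sub>1)"
  define a\<^sub>2 where "a\<^sub>2 = 1 / lam * (lam + of_real c - z\<^sub>2)"
  have ne: "a\<^sub>1 - a\<^sub>2 \<noteq> 0"
    using assms(2,3) by (auto simp: a\<^sub>1_def a\<^sub>2_def field_simps)
  define d where "d = 1 / (a\<^sub>1 - a\<^sub>2)"
  let ?N = "block_mat ((a\<^sub>2 * d) *\<^sub>C ctranspose \<alpha>) (d *\<^sub>C mat 1)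
              ((- a\<^sub>1 * d) *\<^sub>C ctranspose \<alpha>) ((- d) *\<^sub>C mat 1) :: complex^('p + 'p)^('p + 'p)"
  have "E_mat c \<alpha> lam z\<^sub>1 z\<^sub>2 ** ?N = bdiag (a\<^sub>1 * d - a\<^sub>2 * d) (a\<^sub>1 * d - a\<^sub>2 * d)"
    unfolding E_mat_block bdiag_def a\<^sub>1_def [symmetric] a\<^sub>2_def [symmetric]
    by (simp add: block_mat_mult cscale_mult_left cscale_mult_right cscale_cscale
        assms(1) cscale_add_left [symmetric] cscale_zero algebra_simps)
  also have "a\<^sub>1 * d - a\<^sub>2 * d = 1"
    using ne by (simp add: d_def diff_divide_distrib [symmetric])
  finally have "E_mat c \<alpha> lam z\<^sub>1 z\<^sub>2 ** ?N = mat 1"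
    by (simp add: bdiag_1)
  then show ?thesis
    using invertible_right_inverse by blast
qed

text \<open>
  The identity \<open>(cj + \<lambda>jK)E = zEj\<close>.  The upper blocks agree by the choice of the lower blocks of
  \<open>E\<close>; the lower blocks agree exactly because \<open>\<plusminus>z\<close> solve the quadratic equation.
\<close>

lemma E_mat_diagonalizes:
  fixes \<alpha> :: "complex^'p^'p"
  assumes \<alpha>: "\<alpha> ** ctranspose \<alpha> = mat 1" and "lam \<noteq> 0"
    and z: "z\<^sup>2 = of_real c * (2 * lam + of_real c)"
  shows "of_real c *\<^sub>C (J ** E_mat c \<alpha> lam z (- z)) + lam *\<^sub>C (J ** K \<alpha> ** E_mat c \<alpha> lam z (- z)) =
         z *\<^sub>C (E_mat c \<alpha> lam z (- z) ** J)"
proof -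
  \<comment> \<open>The lower blocks contain \<open>\<alpha>\<^sup>* \<alpha>\<close>, which is the identity since \<open>\<alpha>\<close> is square.\<close>
  have \<alpha>': "ctranspose \<alpha> ** \<alpha> = mat 1"
    using \<alpha> by (simp add: matrix_left_right_inverse)
  \<comment> \<open>All blocks are written as scalar multiples, so that sums of products collect to one scalar each.\<close>
  have J: "J = block_mat (1 *\<^sub>C mat 1) 0 0 ((- 1) *\<^sub>C mat 1 :: complex^'p^'p)"
    by (simp add: J_eq_bdiag bdiag_def)
  have K: "K \<alpha> = block_mat (1 *\<^sub>C mat 1) (1 *\<^sub>C \<alpha>) (1 *\<^sub>C ctranspose \<alpha>) (1 *\<^sub>C mat 1)"
    by (simp add: K_def cscale_one)
  \<comment> \<open>The scalar identities of the four blocks; \<open>s\<close> is \<open>z\<close> in the left and \<open>- z\<close> in the right column.\<close>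
  have top: "lam * ((lam + of_real c - s) / lam - 1) - of_real c = - s" for s
    using \<open>lam \<noteq> 0\<close> by (simp add: field_simps)
  have bottom: "lam * (1 - (lam + of_real c - s) / lam) - of_real c * (lam + of_real c - s) / lam =
      s * (lam + of_real c - s) / lam" if "s\<^sup>2 = of_real c * (2 * lam + of_real c)" for s
    using \<open>lam \<noteq> 0\<close> that by (simp add: field_simps power2_eq_square)
  have neg: "z * (- lam - of_real c - z) / lam = - (z * (lam + of_real c + z) / lam)"
    unfolding minus_divide_left by (simp add: algebra_simps)
  show ?thesis
    unfolding E_mat_block J K
    apply (simp only: block_mat_mult block_mat_add cscale_block_mat cscale_mult_left
        cscale_mult_right cscale_cscale matrix_mul_lid matrix_mul_rid \<alpha> \<alpha>' matrix_mult_zero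
        cscale_add_left [symmetric] cscale_zero add_0_left add_0_right)
    using top [of z] top [of "- z"] bottom [of z] bottom [of "- z"] z neg
    by simp
qed

section \<open>The canonical system\<close>

text \<open>
  The hypothesis says that \<open>E\<close> diagonalizes \<open>A = cj + \<lambda>jM\<close>, so \<open>V(x) = E e\<^bsup>izxj\<^esup> E'\<close> solves
  \<open>V' = iAV\<close>.  Differentiating the factor \<open>e\<^bsup>-icxj\<^esup>\<close> of \<open>F = e\<^bsup>-icxj\<^esup>V\<close> cancels the summand \<open>cj\<close> of
  \<open>A\<close> and leaves the term with \<open>M\<close>, conjugated by the rotation.
\<close>

lemma rotated_system_solution:
  fixes M E E' :: "complex^('p::finite + 'p)^('p + 'p)"
  assumes diag: "z *\<^sub>C (E ** J) = c *\<^sub>C (J ** E) + lam *\<^sub>C (J ** M ** E)"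
  defines "F \<equiv> \<lambda>x. rot (- c) x ** E ** rot z x ** E'"
  shows "(F has_vector_derivative (\<i> * lam) *\<^sub>C (J ** (rot (- c) x ** M ** rot c x) ** F x))
           (at x within S)"
proof -
  define V where "V = (\<lambda>x. E ** (rot z x ** E'))"
  have F: "F = (\<lambda>x. rot (- c) x ** V x)"
    by (simp add: F_def V_def matrix_mul_assoc)
  have diag': "z *\<^sub>C (E ** (J ** X)) = c *\<^sub>C (J ** (E ** X)) + lam *\<^sub>C (J ** (M ** (E ** X)))"
    for X :: "complex^('p + 'p)^('p + 'p)"
    using arg_cong [OF diag, of "\<lambda>N. N ** X"]
    by (simp add: cscale_mult_left matrix_add_rdistrib matrix_mul_assoc)
  have rot_cancel: "rot c x ** (rot (- c) x ** X) = X" for X :: "complex^('p + 'p)^('p + 'p)"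
    by (simp add: matrix_mul_assoc rot_mult rot_0)
  have rot_J: "rot (- c) x ** (J ** X) = J ** (rot (- c) x ** X)" for X :: "complex^('p + 'p)^('p + 'p)"
    by (simp add: matrix_mul_assoc rot_J_commute)
  have "(V has_vector_derivative (E ** (rot z x ** 0 + (\<i> * z) *\<^sub>C (J ** rot z x) ** E') +
      0 ** (rot z x ** E'))) (at x within S)"
    unfolding V_def
    by (intro has_vector_derivative_matrix_mult rot_has_vector_derivative has_vector_derivative_const)
  also have "E ** (rot z x ** 0 + (\<i> * z) *\<^sub>C (J ** rot z x) ** E') + 0 ** (rot z x ** E') =
      \<i> *\<^sub>C (z *\<^sub>C (E ** (J ** (rot z x ** E'))))"
    by (simp add: matrix_mult_zero cscale_mult_left cscale_mult_right cscale_cscale matrix_mul_assoc)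
  also have "\<dots> = \<i> *\<^sub>C (c *\<^sub>C (J ** V x) + lam *\<^sub>C (J ** (M ** V x)))"
    by (simp only: diag' V_def)
  finally have "(F has_vector_derivative
      (rot (- c) x ** (\<i> *\<^sub>C (c *\<^sub>C (J ** V x) + lam *\<^sub>C (J ** (M ** V x)))) +
       (\<i> * - c) *\<^sub>C (J ** rot (- c) x) ** V x)) (at x within S)"
    unfolding F by (intro has_vector_derivative_matrix_mult rot_has_vector_derivative)
  also have "rot (- c) x ** (\<i> *\<^sub>C (c *\<^sub>C (J ** V x) + lam *\<^sub>C (J ** (M ** V x)))) +
       (\<i> * - c) *\<^sub>C (J ** rot (- c) x) ** V x = (\<i> * lam) *\<^sub>C (J ** (rot (- c) x ** (M ** V x)))"
    by (simp add: cscale_mult_left cscale_mult_right cscale_cscale cscale_add_right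
        matrix_add_ldistrib matrix_mul_assoc [symmetric] rot_J)
      (simp add: vec_eq_iff algebra_simps)
  also have "\<dots> = (\<i> * lam) *\<^sub>C (J ** (rot (- c) x ** M ** rot c x) ** F x)"
    by (simp add: F matrix_mul_assoc [symmetric] rot_cancel)
  finally show ?thesis .
qed

text \<open>The square of a real number is real, so both square roots of \<open>w\<close> lie off the real axis.\<close>

lemma quadratic_root_upper_half_plane:
  assumes "Im w \<noteq> 0"
  obtains z where "Im z > 0" "{s. s\<^sup>2 = w} = {z, - z}"
proof -
  have im: "Im s \<noteq> 0" if "s\<^sup>2 = w" for s
    using assms that by (auto simp: power2_eq_square)
  define z where "z = (if Im (csqrt w) > 0 then csqrt w else - csqrt w)"
  have z: "z\<^sup>2 = w" by (simp add: z_def)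
  show thesis
  proof
    show "Im z > 0" using im [of "csqrt w"] by (auto simp: z_def simp del: csqrt.sel)
    show "{s. s\<^sup>2 = w} = {z, - z}" unfolding z [symmetric] by (auto simp: power2_eq_iff)
  qed
qed

theorem proposition5p1:
  fixes c :: real and \<alpha> :: "complex^'p^'p" and lam :: complex
  assumes "c \<noteq> 0"
    and "\<alpha> ** ctranspose \<alpha> = mat 1"
    and "Im lam \<noteq> 0"
  shows "\<exists>z\<^sub>1 z\<^sub>2. {z. z\<^sup>2 = of_real c * (2 * lam + of_real c)} = {z\<^sub>1, z\<^sub>2} \<and> Im z\<^sub>1 > 0 \<and> z\<^sub>2 = - z\<^sub>1 \<and>
    invertible (E_mat c \<alpha> lam z\<^sub>1 z\<^sub>2) \<and>
    (\<forall>W :: real \<Rightarrow> complex^('p + 'p)^('p + 'p).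
       fundamental_solution (H c \<alpha>) lam W \<and> W 0 = mat 1 \<longleftrightarrow>
       (\<forall>x\<ge>0. W x =
          mat_exp ((- (\<i> * of_real c * of_real x)) *\<^sub>C J) ** E_mat c \<alpha> lam z\<^sub>1 z\<^sub>2 **
          block_mat (exp (\<i> * z\<^sub>1 * of_real x) *\<^sub>C mat 1) 0
                    0 (exp (\<i> * z\<^sub>2 * of_real x) *\<^sub>C mat 1) **
          matrix_inv (E_mat c \<alpha> lam z\<^sub>1 z\<^sub>2)))"
proof -
  obtain z where z: "Im z > 0" "{s. s\<^sup>2 = of_real c * (2 * lam + of_real c)} = {z, - z}"
    using quadratic_root_upper_half_plane [of "of_real c * (2 * lam + of_real c)"] assms by auto
  define E where "E = E_mat c \<alpha> lam z (- z)"
  define F where "F = (\<lambda>x. rot (- of_real c) x ** E ** rot z x ** matrix_inv E)"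
  \<comment> \<open>\<open>Y\<close> is the pointwise inverse of \<open>F\<close>, written as a product to make it visibly differentiable.\<close>
  define Y where "Y = (\<lambda>x. E ** rot (- z) x ** matrix_inv E ** rot (of_real c) x)"
  define B where "B = (\<lambda>x. (\<i> * lam) *\<^sub>C (J ** H c \<alpha> x))"
  have H: "H c \<alpha> x = rot (- of_real c) x ** K \<alpha> ** rot (of_real c) x" for x
    by (simp only: H_def rot_eq_mat_exp)
  have "lam \<noteq> 0" "z \<noteq> - z" using assms(3) z(1) by auto
  have invE: "invertible E"
    unfolding E_def using assms(2) \<open>lam \<noteq> 0\<close> \<open>z \<noteq> - z\<close> by (rule invertible_E_mat)
  note inv = invertible_matrix_inv [OF invE]
  have inv': "E ** (matrix_inv E ** X) = X" "matrix_inv E ** (E ** X) = X"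
    for X :: "complex^('p + 'p)^('p + 'p)"
    using inv by (simp_all add: matrix_mul_assoc)
  have rot': "rot (- a) x ** (rot a x ** X) = X" "rot a x ** (rot (- a) x ** X) = X"
    for a x and X :: "complex^('p + 'p)^('p + 'p)"
    by (simp_all add: matrix_mul_assoc rot_mult rot_0)
  have FY: "F x ** Y x = mat 1" for x
    by (simp_all add: F_def Y_def matrix_mul_assoc [symmetric] inv inv' rot' rot_mult rot_0)
  have F0: "F 0 = mat 1"
    by (simp add: F_def rot_0 inv)
  have "z\<^sup>2 = of_real c * (2 * lam + of_real c)" using z(2) by auto
  from rotated_system_solution [OF E_mat_diagonalizes [OF assms(2) \<open>lam \<noteq> 0\<close> this, symmetric]]
  have F_deriv: "(F has_vector_derivative B x ** F x) (at x within {0..})" for x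
    by (simp add: F_def E_def B_def H cscale_mult_left)
  have Y_diff: "\<exists>D. (Y has_vector_derivative D) (at x within {0..})" for x
    unfolding Y_def
    apply (rule exI)
    apply (rule has_vector_derivative_matrix_mult)
     apply (rule has_vector_derivative_matrix_mult)
     apply (rule has_vector_derivative_matrix_mult)
    apply (rule rot_has_vector_derivative has_vector_derivative_const)+
    done
  have solution: "canonical_solution (H c \<alpha>) lam W \<longleftrightarrow>
      (\<forall>x\<ge>0. (W has_vector_derivative B x ** W x) (at x within {0..}))" for W
    by (simp add: canonical_solution_def B_def cscale_mult_left)
  have "fundamental_solution (H c \<alpha>) lam W \<and> W 0 = mat 1 \<longleftrightarrow> (\<forall>x\<ge>0. W x = F x)" for W
  proof
    assume "fundamental_solution (H c \<alpha>) lam W \<and> W 0 = mat 1"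
    then have "\<And>x. x \<ge> 0 \<Longrightarrow> (W has_vector_derivative B x ** W x) (at x within {0..})" "W 0 = F 0"
      by (auto simp: fundamental_solution_def solution F0)
    then show "\<forall>x\<ge>0. W x = F x"
      using linear_system_unique [OF F_deriv FY Y_diff] by blast
  next
    assume W: "\<forall>x\<ge>0. W x = F x"
    have "(W has_vector_derivative B x ** W x) (at x within {0..})" if "x \<ge> 0" for x
      using has_vector_derivative_transform [of x "{0..}" W F, OF _ _ F_deriv] W that by auto
    moreover have "invertible (W x)" if "x \<ge> 0" for x
      using W that FY [of x] invertible_right_inverse by auto
    ultimately show "fundamental_solution (H c \<alpha>) lam W \<and> W 0 = mat 1"
      using W F0 by (simp add: fundamental_solution_def solution)
  qed
  moreover have "F x = mat_exp ((- (\<i> * of_real c * of_real x)) *\<^sub>C J) ** E **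
      block_mat (exp (\<i> * z * of_real x) *\<^sub>C mat 1) 0 0 (exp (\<i> * - z * of_real x) *\<^sub>C mat 1) **
      matrix_inv E" for x
    unfolding rot_eq_mat_exp F_def by (simp add: rot_def bdiag_def)
  ultimately show ?thesis
    using z invE unfolding E_def by (intro exI [of _ z] exI [of _ "- z"]) simp
qed

end
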